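(* Let $\mathcal{H}$ be a complex Hilbert space and let $T\in\mathcal{B}(\mathcal{H})$. Then the following inequalities hold: (i) $dw^2(T)\leq \left\||T|^2+|T|^4\right\|$; (ii) $dw^2(T)\leq \frac{1}{2}\left(w(T^2)+\|T\|^2\right)+\|T\|^4$.
   Context: $\mathcal{B}(\mathcal{H})$ is the algebra of bounded linear operators on the complex Hilbert space $\mathcal{H}$, with operator norm $\|\cdot\|$. For $T\in\mathcal{B}(\mathcal{H})$: $|T|=(T^*T)^{1/2}$; the numerical radius is $w(T)=\sup\{|\langle Tx,x\rangle|: \|x\|=1\}$; the Davis-Wielandt radius is $dw(T)=\sup\{\sqrt{|\langle Tx,x\rangle|^2+\|Tx\|^4}: \|x\|=1\}$, with $x$ ranging over unit vectors of $\mathcal{H}$; $dw^2(T)=(dw(T))^2$. *)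

theory Defs
  imports "HOL-Analysis.Analysis"
begin

class complex_vector = real_vector +
  fixes scaleC :: "complex \<Rightarrow> 'a \<Rightarrow> 'a" (infixr "*\<^sub>C" 75)
  assumes scaleC_add_right: "a *\<^sub>C (x + y) = a *\<^sub>C x + a *\<^sub>C y"
    and scaleC_add_left: "(a + b) *\<^sub>C x = a *\<^sub>C x + b *\<^sub>C x"
    and scaleC_scaleC: "a *\<^sub>C (b *\<^sub>C x) = (a * b) *\<^sub>C x"
    and scaleR_scaleC: "r *\<^sub>R x = complex_of_real r *\<^sub>C x"

text \<open>
  The inner product is linear in the first argument. The class \<open>real_normed_vector\<close> only supplies
  the norm and its metric topology to the library; its axioms follow from the others,
  since the norm is required to be the one induced by the inner product.
\<close>

class complex_inner = complex_vector + real_normed_vector +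
  fixes cinner :: "'a \<Rightarrow> 'a \<Rightarrow> complex"
  assumes cinner_commute: "cinner x y = cnj (cinner y x)"
    and cinner_add_left: "cinner (x + y) z = cinner x z + cinner y z"
    and cinner_scaleC_left: "cinner (c *\<^sub>C x) y = c * cinner x y"
    and cinner_ge_zero: "0 \<le> Re (cinner x x)"
    and cinner_eq_zero_iff: "cinner x x = 0 \<longleftrightarrow> x = 0"
    and norm_eq_sqrt_cinner: "norm x = sqrt (Re (cinner x x))"

class chilbert_space = complex_inner + complete_space

instantiation complex :: chilbert_space
begin

definition scaleC_complex :: "complex \<Rightarrow> complex \<Rightarrow> complex" where
  "scaleC_complex c x = c * x"

definition cinner_complex :: "complex \<Rightarrow> complex \<Rightarrow> complex" where
  "cinner_complex x y = x * cnj y"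

instance
  by standard
    (auto simp: scaleC_complex_def cinner_complex_def algebra_simps scaleR_conv_of_real
      norm_complex_def power2_eq_square)

end

definition bounded_clinear :: "('a::complex_inner \<Rightarrow> 'b::complex_inner) \<Rightarrow> bool" where
  "bounded_clinear T \<longleftrightarrow> bounded_linear T \<and> (\<forall>c x. T (c *\<^sub>C x) = c *\<^sub>C T x)"

definition cadjoint :: "('a::chilbert_space \<Rightarrow> 'a) \<Rightarrow> 'a \<Rightarrow> 'a" where
  "cadjoint T = (THE S. \<forall>x y. cinner (T x) y = cinner x (S y))"

definition positive_op :: "('a::chilbert_space \<Rightarrow> 'a) \<Rightarrow> bool" where
  "positive_op P \<longleftrightarrow>
     bounded_clinear P \<and> (\<forall>x. Im (cinner (P x) x) = 0 \<and> 0 \<le> Re (cinner (P x) x))"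

text \<open>The positive square root of a positive operator, which exists and is unique.\<close>

definition sqrt_op :: "('a::chilbert_space \<Rightarrow> 'a) \<Rightarrow> 'a \<Rightarrow> 'a" where
  "sqrt_op A = (THE P. positive_op P \<and> P \<circ> P = A)"

definition abs_op :: "('a::chilbert_space \<Rightarrow> 'a) \<Rightarrow> 'a \<Rightarrow> 'a" where
  "abs_op T = sqrt_op (cadjoint T \<circ> T)"

text \<open>
  Both radii are suprema of sets of nonnegative reals. Inserting \<open>0\<close> does not change the supremum
  if there is a unit vector; on the zero space, which has none, it fixes the value \<open>0\<close>, where
  \<open>Sup {}\<close> would be an unspecified real number.
\<close>

definition numerical_radius :: "('a::chilbert_space \<Rightarrow> 'a) \<Rightarrow> real" where
  "numerical_radius T = Sup (insert 0 {cmod (cinner (T x) x) |x. norm x = 1})"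

definition davis_wielandt_radius :: "('a::chilbert_space \<Rightarrow> 'a) \<Rightarrow> real" where
  "davis_wielandt_radius T =
     Sup (insert 0 {sqrt ((cmod (cinner (T x) x))\<^sup>2 + norm (T x) ^ 4) |x. norm x = 1})"

end

theory Submission
  imports Defs
begin

text \<open>
  Write \<open>A = T\<^sup>*T = |T|\<^sup>2\<close> and let \<open>x\<close> be a unit vector. For (i),
  \<open>|\<langle>Tx,x\<rangle>|\<^sup>2 \<le> \<parallel>Tx\<parallel>\<^sup>2 = \<langle>Ax,x\<rangle>\<close> and
  \<open>\<parallel>Tx\<parallel>\<^sup>4 = \<langle>Ax,x\<rangle>\<^sup>2 \<le> \<parallel>Ax\<parallel>\<^sup>2 = \<langle>A\<^sup>2x,x\<rangle>\<close>. For (ii), Buzano's inequality applied to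
  \<open>Tx\<close>, \<open>T\<^sup>*x\<close> bounds \<open>|\<langle>Tx,x\<rangle>|\<^sup>2\<close> by half of
  \<open>|\<langle>T\<^sup>2x,x\<rangle>| + \<parallel>Tx\<parallel> \<parallel>T\<^sup>*x\<parallel>\<close>.
  The positive square root of \<open>A\<close> comes from the iteration \<open>Y \<mapsto> (B + Y\<^sup>2)/2\<close>, whose increments
  are dominated in norm by those of the scalar iteration \<open>y \<mapsto> (1 + y\<^sup>2)/2\<close>; it is unique because
  the limit commutes with everything that commutes with \<open>A\<close>.
\<close>

section \<open>Complex inner products\<close>

lemma cinner_add_right: "cinner x (y + z) = cinner x y + cinner x z"
  by (metis cinner_commute cinner_add_left complex_cnj_add)

lemma cinner_scaleC_right: "cinner x (c *\<^sub>C y) = cnj c * cinner x y"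
  by (metis cinner_commute cinner_scaleC_left complex_cnj_mult)

lemma cinner_scaleR_left: "cinner (r *\<^sub>R x) y = complex_of_real r * cinner x y"
  by (simp add: scaleR_scaleC cinner_scaleC_left)

lemma cinner_scaleR_right: "cinner x (r *\<^sub>R y) = complex_of_real r * cinner x y"
  by (simp add: scaleR_scaleC cinner_scaleC_right)

lemma cinner_minus_left: "cinner (- x) y = - cinner x y"
  using cinner_scaleR_left[of "-1" x y] by simp

lemma cinner_minus_right: "cinner x (- y) = - cinner x y"
  using cinner_scaleR_right[of x "-1" y] by simp

lemma cinner_diff_left: "cinner (x - y) z = cinner x z - cinner y z"
  using cinner_add_left[of x "- y" z] by (simp add: cinner_minus_left)

lemma cinner_diff_right: "cinner x (y - z) = cinner x y - cinner x z"
  using cinner_add_right[of x y "- z"] by (simp add: cinner_minus_right)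

lemmas cinner_simps = cinner_add_left cinner_add_right cinner_diff_left cinner_diff_right
  cinner_scaleR_left cinner_scaleR_right cinner_scaleC_left cinner_scaleC_right

lemma Re_cinner_commute: "Re (cinner x y) = Re (cinner y x)"
  by (metis cinner_commute cnj.simps(1))

lemma Re_cinner_self: "Re (cinner x x) = (norm x)\<^sup>2"
  by (simp add: norm_eq_sqrt_cinner cinner_ge_zero)

lemma cinner_self: "cinner x x = complex_of_real ((norm x)\<^sup>2)"
proof -
  have "Im (cinner x x) = 0"
    using arg_cong[OF cinner_commute[of x x], of Im] by simp
  then show ?thesis
    by (simp add: complex_eq_iff Re_cinner_self)
qed

lemma cinner_eqI:
  assumes "\<And>z. cinner z x = cinner z y"
  shows "x = y"
  using assms[of "x - y"] cinner_eq_zero_iff[of "x - y"] by (simp add: cinner_diff_right)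

text \<open>The real parameter \<open>t\<close> serves the variational step of the Riesz argument;
  at \<open>t = 1\<close> and \<open>t = -1\<close> this supplies the parallelogram law.\<close>

lemma norm_add_scaleR_squared:
  "(norm (x + t *\<^sub>R y))\<^sup>2 = (norm x)\<^sup>2 + 2 * t * Re (cinner x y) + t\<^sup>2 * (norm y)\<^sup>2"
  unfolding Re_cinner_self[symmetric]
  using Re_cinner_commute[of x y] by (simp add: cinner_simps power2_eq_square algebra_simps)

lemma norm_diff_squared:
  "(norm (x - y))\<^sup>2 = (norm x)\<^sup>2 - 2 * Re (cinner x y) + (norm y)\<^sup>2"
  using norm_add_scaleR_squared[of x "-1" y] by simp

lemma norm_scaleC: "norm (c *\<^sub>C (x::'a::complex_inner)) = cmod c * norm x"
proof -
  have "cinner (c *\<^sub>C x) (c *\<^sub>C x) = (c * cnj c) * cinner x x"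
    by (simp add: cinner_simps)
  also have "\<dots> = complex_of_real ((cmod c)\<^sup>2 * (norm x)\<^sup>2)"
    by (simp only: cinner_self complex_norm_square[symmetric] of_real_mult of_real_power)
  finally have "(norm (c *\<^sub>C x))\<^sup>2 = (cmod c * norm x)\<^sup>2"
    by (simp only: cinner_self of_real_eq_iff power_mult_distrib)
  then show ?thesis
    by (simp add: power2_eq_iff_nonneg)
qed

text \<open>The vector \<open>(norm y)\<^sup>2 *\<^sub>R x - cinner x y *\<^sub>C y\<close> is a
  division-free multiple of the part of \<open>x\<close> orthogonal to \<open>y\<close>; its squared
  norm is \<open>(norm y)\<^sup>2\<close> times the difference of the squares to be
  compared.\<close>

lemma cinner_Cauchy_Schwarz: "cmod (cinner x y) \<le> norm x * norm y"
proof (cases "y = 0")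
  case True
  then show ?thesis
    using cinner_scaleR_right[of x 0 0] by simp
next
  case False
  define c where "c = cinner x y"
  have "0 \<le> (norm ((norm y)\<^sup>2 *\<^sub>R x - c *\<^sub>C y))\<^sup>2"
    by simp
  also have "\<dots> = (norm y)^4 * (norm x)\<^sup>2 - 2 * (norm y)\<^sup>2 * (cmod c)\<^sup>2 + (cmod c)\<^sup>2 * (norm y)\<^sup>2"
  proof -
    have "Re (cinner ((norm y)\<^sup>2 *\<^sub>R x) (c *\<^sub>C y)) = (norm y)\<^sup>2 * (cmod c)\<^sup>2"
      unfolding cmod_power2 by (simp add: cinner_simps flip: c_def) (simp add: power2_eq_square algebra_simps)
    then show ?thesis
      by (simp add: norm_diff_squared norm_scaleC power_mult_distrib flip: power_mult)
  qed
  also have "\<dots> = (norm y)\<^sup>2 * ((norm x * norm y)\<^sup>2 - (cmod c)\<^sup>2)"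
    by (simp add: algebra_simps power_mult_distrib power4_eq_xxxx power2_eq_square)
  finally have "(cmod c)\<^sup>2 \<le> (norm x * norm y)\<^sup>2"
    using False by (simp add: zero_le_mult_iff)
  then show ?thesis
    unfolding c_def by (rule power2_le_imp_le) simp
qed

text \<open>Real scalars do not see the conjugation in the second slot, so the form is bilinear over
  the reals; Cauchy-Schwarz gives the bound 1, and hence continuity.\<close>

lemma bounded_bilinear_cinner: "bounded_bilinear cinner"
  by standard (auto simp: cinner_simps scaleR_conv_of_real intro!: exI[of _ 1] cinner_Cauchy_Schwarz)

lemma tendsto_cinner [tendsto_intros]:
  "\<lbrakk>(f \<longlongrightarrow> a) F; (g \<longlongrightarrow> b) F\<rbrakk> \<Longrightarrow> ((\<lambda>x. cinner (f x) (g x)) \<longlongrightarrow> cinner a b) F"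
  by (rule bounded_bilinear.tendsto[OF bounded_bilinear_cinner])

text \<open>The vector \<open>2\<langle>a,e\<rangle>e - a\<close> is a reflection of \<open>a\<close>, so it has the same norm;
  pair it with \<open>b\<close>.\<close>

lemma Buzano:
  assumes "norm e = 1"
  shows "cmod (cinner a e * cinner e b) \<le> (cmod (cinner a b) + norm a * norm b) / 2"
proof -
  define v where "v = (2 * cinner a e) *\<^sub>C e - a"
  have "Re (cinner ((2 * cinner a e) *\<^sub>C e) a) = 2 * (cmod (cinner a e))\<^sup>2"
    using cinner_commute[of e a]
    by (simp add: cinner_simps cmod_power2) (simp add: power2_eq_square)
  then have "(norm v)\<^sup>2 = (norm a)\<^sup>2"
    by (simp add: v_def norm_diff_squared norm_scaleC norm_mult assms power_mult_distrib)
  then have "norm v = norm a"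
    by (simp add: power2_eq_iff_nonneg)
  moreover have "cinner v b = 2 * (cinner a e * cinner e b) - cinner a b"
    by (simp add: v_def cinner_simps)
  ultimately have "cmod (2 * (cinner a e * cinner e b) - cinner a b) \<le> norm a * norm b"
    using cinner_Cauchy_Schwarz[of v b] by simp
  moreover have "cmod (2 * (cinner a e * cinner e b))
      \<le> cmod (2 * (cinner a e * cinner e b) - cinner a b) + cmod (cinner a b)"
    using norm_triangle_ineq[of "2 * (cinner a e * cinner e b) - cinner a b" "cinner a b"] by simp
  ultimately show ?thesis
    by (simp add: norm_mult)
qed

section \<open>Riesz representation and adjoints\<close>

instance chilbert_space \<subseteq> banach ..

text \<open>Near \<open>t = 0\<close> the linear term dominates. The witness
  \<open>t = - (a / d)\<close> with \<open>d = \<bar>b\<bar> + 1\<close>, a positive majorant of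
  \<open>b\<close>, makes the expression at most \<open>- (a\<^sup>2 / d)\<close>.\<close>

lemma quadratic_nonneg_imp_linear_zero:
  fixes a b :: real
  assumes "\<And>t. 0 \<le> 2 * t * a + t\<^sup>2 * b"
  shows "a = 0"
proof -
  define d where "d = \<bar>b\<bar> + 1"
  have "0 \<le> 2 * (- (a / d)) * a + (- (a / d))\<^sup>2 * b"
    by (rule assms)
  also have "\<dots> \<le> 2 * (- (a / d)) * a + (- (a / d))\<^sup>2 * d"
    by (intro add_left_mono mult_left_mono) (auto simp: d_def)
  also have "\<dots> = - (a\<^sup>2 / d)"
  proof -
    have "0 < d"
      by (simp add: d_def)
    then show ?thesis
      by (simp add: power2_eq_square field_simps)
  qed
  finally have "a\<^sup>2 / d \<le> 0"
    by simp
  then show ?thesis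
    by (simp add: d_def divide_le_0_iff) (smt (verit))
qed

text \<open>The representing vector minimises \<open>J v = \<parallel>v\<parallel>\<^sup>2 - 2 Re (f v)\<close>; minimising sequences
  are Cauchy by the parallelogram law.\<close>

lemma Riesz_representation_real:
  fixes f :: "'a::chilbert_space \<Rightarrow> real"
  assumes "bounded_linear f"
  shows "\<exists>y. \<forall>x. f x = Re (cinner x y)"
proof -
  interpret bounded_linear f by fact
  define J where "J v = (norm v)\<^sup>2 - 2 * f v" for v
  obtain K where K: "\<And>x. norm (f x) \<le> norm x * K"
    using bounded by blast
  \<comment> \<open>Boundedness of \<open>f\<close> and completing the square.\<close>
  have J_lower: "- (K\<^sup>2) \<le> J v" for v
  proof -
    have "f v \<le> norm v * K"
      using K[of v] by simp
    moreover have "0 \<le> (norm v - K)\<^sup>2"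
      by simp
    ultimately show ?thesis
      unfolding J_def by (simp add: power2_diff)
  qed
  define m where "m = Inf (range J)"
  have bdd: "bdd_below (range J)"
    using J_lower by (auto intro: bdd_belowI[of _ "- (K\<^sup>2)"])
  have m_le: "m \<le> J v" for v
    unfolding m_def by (rule cInf_lower[OF _ bdd]) simp
  have "\<exists>v. J v < m + 1 / real (Suc n)" for n
    using cInf_lessD[of "range J" "m + 1 / real (Suc n)"] unfolding m_def by auto
  then obtain u where u: "\<And>n. J (u n) < m + 1 / real (Suc n)"
    by metis
  \<comment> \<open>The midpoint cannot undercut \<open>m\<close>, so the excesses of
    \<open>J\<close> over \<open>m\<close> control the distance.\<close>
  have dist: "(norm (x - y))\<^sup>2 \<le> 2 * (J x - m) + 2 * (J y - m)" for x y
  proof -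
    have "J ((1/2) *\<^sub>R (x + y)) = (norm (x + y))\<^sup>2 / 4 - f x - f y"
      by (simp only: J_def scaleR add norm_scaleR) (simp add: power_mult_distrib power2_eq_square field_simps)
    then have "J x + J y - 2 * J ((1/2) *\<^sub>R (x + y)) = (norm (x - y))\<^sup>2 / 2"
      using norm_add_scaleR_squared[of x 1 y] norm_diff_squared[of x y] J_def[of x] J_def[of y]
      by (simp add: field_simps)
    then show ?thesis
      using m_le[of "(1/2) *\<^sub>R (x + y)"] by simp
  qed
  have "Cauchy u"
  proof (rule metric_CauchyI)
    fix e :: real
    assume "0 < e"
    \<comment> \<open>For \<open>k \<ge> N\<close> this gives
      \<open>1 / real (Suc k) < e\<^sup>2 / 4\<close>, so each of the two terms in
      \<open>dist\<close> stays below \<open>e\<^sup>2 / 2\<close>.\<close>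
    then obtain N where N: "4 / e\<^sup>2 < real N"
      using reals_Archimedean2 by blast
    have "norm (u i - u j) < e" if "N \<le> i" "N \<le> j" for i j
    proof -
      have le: "4 * (J (u k) - m) < e\<^sup>2" if "N \<le> k" for k
      proof -
        have "4 / e\<^sup>2 < real (Suc k)"
          using N that by simp
        then have "1 / real (Suc k) < e\<^sup>2 / 4"
          using \<open>0 < e\<close> by (simp add: field_simps)
        then show ?thesis
          using u[of k] by argo
      qed
      have "(norm (u i - u j))\<^sup>2 < e\<^sup>2"
        using dist[of "u i" "u j"] le[OF that(1)] le[OF that(2)] by argo
      then show ?thesis
        using \<open>0 < e\<close> by (intro power2_less_imp_less[of _ e]) auto
    qed
    then show "\<exists>M. \<forall>i\<ge>M. \<forall>j\<ge>M. dist (u i) (u j) < e"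
      by (auto simp: dist_norm)
  qed
  then obtain y where y: "u \<longlonglongrightarrow> y"
    using Cauchy_convergent convergentD by blast
  have "(\<lambda>n. J (u n)) \<longlonglongrightarrow> J y"
    unfolding J_def by (intro tendsto_intros y tendsto)
  moreover have "(\<lambda>n. m + 1 / real (Suc n)) \<longlonglongrightarrow> m + 0"
    by (intro tendsto_intros LIMSEQ_Suc lim_1_over_n)
  ultimately have "J y \<le> m"
    using u by (intro LIMSEQ_le[of "\<lambda>n. J (u n)" _ "\<lambda>n. m + 1 / real (Suc n)"]) (auto intro: less_imp_le)
  \<comment> \<open>First-order condition: half the derivative of
    \<open>J (y + t *\<^sub>R x)\<close> at \<open>t = 0\<close> vanishes at the minimiser
    \<open>y\<close>.\<close>
  have "Re (cinner y x) - f x = 0" for x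
  proof (rule quadratic_nonneg_imp_linear_zero)
    fix t :: real
    have "J y \<le> J (y + t *\<^sub>R x)"
      using \<open>J y \<le> m\<close> m_le by (rule order_trans)
    then show "0 \<le> 2 * t * (Re (cinner y x) - f x) + t\<^sup>2 * (norm x)\<^sup>2"
      unfolding J_def norm_add_scaleR_squared by (simp add: add scaleR algebra_simps)
  qed
  then show ?thesis
    using Re_cinner_commute by (metis eq_iff_diff_eq_0)
qed

section \<open>Adjoints of bounded complex-linear operators\<close>

lemma bounded_clinear_bounded_linear: "bounded_clinear T \<Longrightarrow> bounded_linear T"
  by (simp add: bounded_clinear_def)

lemma bounded_clinear_scaleC: "bounded_clinear T \<Longrightarrow> T (c *\<^sub>C x) = c *\<^sub>C T x"
  by (simp add: bounded_clinear_def)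

lemma cadjoint_exists:
  fixes T :: "'a::chilbert_space \<Rightarrow> 'a"
  assumes "bounded_clinear T"
  shows "\<exists>S. \<forall>x y. cinner (T x) y = cinner x (S y)"
proof -
  have "\<exists>z. \<forall>x. cinner (T x) y = cinner x z" for y
  proof -
    have "bounded_linear (\<lambda>x. Re (cinner (T x) y))"
      by (intro bounded_linear_compose[OF bounded_linear_Re]
          bounded_linear_compose[OF bounded_bilinear.bounded_linear_left[OF bounded_bilinear_cinner]]
          bounded_clinear_bounded_linear assms)
    then obtain z where z: "\<And>x. Re (cinner (T x) y) = Re (cinner x z)"
      using Riesz_representation_real by blast
    \<comment> \<open>The real representation matches real parts only; at
      \<open>\<i> *\<^sub>C x\<close> it matches the imaginary parts.\<close>
    have "cinner (T x) y = cinner x z" for x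
      using z[of x] z[of "\<i> *\<^sub>C x"]
      by (simp add: complex_eq_iff cinner_simps bounded_clinear_scaleC[OF assms])
    then show ?thesis by blast
  qed
  then show ?thesis by metis
qed

text \<open>Two candidates for the adjoint agree when tested against every vector, so the definite
  description in \<open>cadjoint\<close> denotes the one obtained from Riesz.\<close>

lemma cinner_cadjoint:
  fixes T :: "'a::chilbert_space \<Rightarrow> 'a"
  assumes "bounded_clinear T"
  shows "cinner (T x) y = cinner x (cadjoint T y)"
proof -
  obtain S where S: "\<forall>x y. cinner (T x) y = cinner x (S y)"
    using cadjoint_exists[OF assms] by blast
  have "cadjoint T = S"
    unfolding cadjoint_def
  proof (rule the_equality)
    show "\<forall>x y. cinner (T x) y = cinner x (S y)"
      by (rule S)
    fix R
    assume R: "\<forall>x y. cinner (T x) y = cinner x (R y)"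
    show "R = S"
    proof (rule ext, rule cinner_eqI)
      show "cinner z (R y) = cinner z (S y)" for y z
        using R[rule_format, of z y] S[rule_format, of z y] by simp
    qed
  qed
  then show ?thesis
    using S by simp
qed

text \<open>Write the square of the left side as the real part of
  \<open>cinner (T (cadjoint T y)) y\<close>, estimate by Cauchy-Schwarz and cancel one factor
  \<open>norm (cadjoint T y)\<close>, unless it is zero.\<close>

lemma norm_cadjoint_le:
  fixes T :: "'a::chilbert_space \<Rightarrow> 'a"
  assumes "bounded_clinear T"
  shows "norm (cadjoint T y) \<le> onorm T * norm y"
proof -
  have "(norm (cadjoint T y))\<^sup>2 = Re (cinner (T (cadjoint T y)) y)"
    by (simp add: cinner_cadjoint[OF assms] Re_cinner_self)
  also have "\<dots> \<le> norm (T (cadjoint T y)) * norm y"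
    using complex_Re_le_cmod cinner_Cauchy_Schwarz by (rule order_trans)
  also have "\<dots> \<le> onorm T * norm (cadjoint T y) * norm y"
    by (intro mult_right_mono onorm bounded_clinear_bounded_linear assms) simp
  finally have "norm (cadjoint T y) * norm (cadjoint T y) \<le> norm (cadjoint T y) * (onorm T * norm y)"
    by (simp add: power2_eq_square mult_ac)
  then show ?thesis
    using onorm_pos_le[OF bounded_clinear_bounded_linear[OF assms]]
    by (cases "cadjoint T y = 0") auto
qed

lemma bounded_clinear_cadjoint:
  fixes T :: "'a::chilbert_space \<Rightarrow> 'a"
  assumes "bounded_clinear T"
  shows "bounded_clinear (cadjoint T)"
proof -
  note adj = cinner_cadjoint[OF assms, symmetric]
  have scale: "cadjoint T (c *\<^sub>C x) = c *\<^sub>C cadjoint T x" for c x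
    by (rule cinner_eqI) (simp add: adj cinner_simps)
  have "bounded_linear (cadjoint T)"
  proof
    show "cadjoint T (x + y) = cadjoint T x + cadjoint T y" for x y
      by (rule cinner_eqI) (simp add: adj cinner_simps)
    show "cadjoint T (r *\<^sub>R x) = r *\<^sub>R cadjoint T x" for r x
      by (simp add: scaleR_scaleC scale)
    show "\<exists>K. \<forall>x. norm (cadjoint T x) \<le> norm x * K"
      using norm_cadjoint_le[OF assms] by (auto simp: mult.commute)
  qed
  then show ?thesis
    by (simp add: bounded_clinear_def scale)
qed

lemma bounded_clinear_compose:
  "\<lbrakk>bounded_clinear S; bounded_clinear T\<rbrakk> \<Longrightarrow> bounded_clinear (S \<circ> T)"
  unfolding bounded_clinear_def o_def by (auto intro: bounded_linear_compose)

lemma positive_op_cadjoint_comp: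
  fixes T :: "'a::chilbert_space \<Rightarrow> 'a"
  assumes "bounded_clinear T"
  shows "positive_op (cadjoint T \<circ> T)"
proof -
  have "cinner ((cadjoint T \<circ> T) x) x = complex_of_real ((norm (T x))\<^sup>2)" for x
    using cinner_commute[of "cadjoint T (T x)" x]
    by (simp add: cinner_self flip: cinner_cadjoint[OF assms])
  then show ?thesis
    unfolding positive_op_def
    by (simp add: bounded_clinear_compose bounded_clinear_cadjoint assms del: o_apply)
qed

section \<open>Positive operators and square roots\<close>

lemma positive_op_bounded_linear: "positive_op P \<Longrightarrow> bounded_linear P"
  by (simp add: positive_op_def bounded_clinear_def)

text \<open>Polarization of the real quadratic form \<open>\<langle>Pz,z\<rangle>\<close> at \<open>z = x + y\<close> and \<open>z = x + iy\<close>.\<close>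

lemma positive_op_selfadjoint:
  fixes P :: "'a::chilbert_space \<Rightarrow> 'a"
  assumes "positive_op P"
  shows "cinner (P x) y = cinner x (P y)"
proof -
  interpret bounded_linear P
    using assms by (rule positive_op_bounded_linear)
  have im: "Im (cinner (P z) z) = 0" for z
    using assms by (simp add: positive_op_def)
  have sc: "P (c *\<^sub>C z) = c *\<^sub>C P z" for c z
    using assms by (simp add: positive_op_def bounded_clinear_def)
  have "Im (cinner (P x) y) + Im (cinner (P y) x) = 0"
    using im[of "x + y"] im[of x] im[of y] by (simp add: add cinner_simps)
  \<comment> \<open>The factors \<open>-\<i>\<close> and \<open>\<i>\<close> on the two cross terms
    turn their imaginary parts into real parts.\<close>
  moreover have "Re (cinner (P x) y) = Re (cinner (P y) x)"
    using im[of "x + \<i> *\<^sub>C y"] im[of x] im[of y] by (simp add: add sc cinner_simps)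
  ultimately have "cinner (P x) y = cnj (cinner (P y) x)"
    by (simp add: complex_eq_iff)
  then show ?thesis
    using cinner_commute[of x "P y"] by simp
qed

text \<open>Evaluate the quadratic form of \<open>P\<close> at \<open>x - Px / K\<close>.\<close>

lemma positive_op_norm_squared_le:
  fixes P :: "'a::chilbert_space \<Rightarrow> 'a"
  assumes "positive_op P" "0 < K" "\<And>x. norm (P x) \<le> K * norm x"
  shows "(norm (P x))\<^sup>2 \<le> K * Re (cinner (P x) x)"
proof -
  interpret bounded_linear P
    using assms(1) by (rule positive_op_bounded_linear)
  define t where "t = 1 / K"
  have t: "t * K = 1" "0 < t"
    using assms(2) by (auto simp: t_def)
  have "0 \<le> Re (cinner (P (x - t *\<^sub>R P x)) (x - t *\<^sub>R P x))"
    using assms(1) by (simp add: positive_op_def)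
  also have "\<dots> = Re (cinner (P x) x) - 2 * t * (norm (P x))\<^sup>2 + t\<^sup>2 * Re (cinner (P (P x)) (P x))"
    using positive_op_selfadjoint[OF assms(1), of "P x" x]
    by (simp add: diff scaleR cinner_simps Re_cinner_self power2_eq_square algebra_simps)
  also have "\<dots> \<le> Re (cinner (P x) x) - 2 * t * (norm (P x))\<^sup>2 + t\<^sup>2 * (K * (norm (P x))\<^sup>2)"
  proof -
    have "Re (cinner (P (P x)) (P x)) \<le> norm (P (P x)) * norm (P x)"
      using complex_Re_le_cmod cinner_Cauchy_Schwarz by (rule order_trans)
    also have "\<dots> \<le> K * norm (P x) * norm (P x)"
      using assms(3) by (intro mult_right_mono) auto
    finally show ?thesis
      by (intro add_left_mono mult_left_mono) (auto simp: power2_eq_square mult_ac)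
  qed
  \<comment> \<open>Since \<open>t = 1 / K\<close>, the quadratic term cancels exactly half of the
    negative one.\<close>
  also have "\<dots> = Re (cinner (P x) x) - t * (norm (P x))\<^sup>2"
  proof -
    have "t\<^sup>2 * (K * (norm (P x))\<^sup>2) = (t * K) * t * (norm (P x))\<^sup>2"
      by (simp only: power2_eq_square mult_ac)
    then show ?thesis
      using t by simp
  qed
  finally have "t * (norm (P x))\<^sup>2 \<le> Re (cinner (P x) x)"
    by simp
  then show ?thesis
    using assms(2) by (simp add: t_def field_simps)
qed

lemma positive_op_bound:
  fixes P :: "'a::chilbert_space \<Rightarrow> 'a"
  assumes "positive_op P"
  obtains K where "0 < K" "\<And>x. norm (P x) \<le> K * norm x"
  using bounded_linear.pos_bounded[OF positive_op_bounded_linear[OF assms]]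
  by (auto simp: mult.commute)

lemma positive_op_eq_zero:
  fixes P :: "'a::chilbert_space \<Rightarrow> 'a"
  assumes "positive_op P" "Re (cinner (P x) x) = 0"
  shows "P x = 0"
proof -
  obtain K where "0 < K" "\<And>x. norm (P x) \<le> K * norm x"
    using positive_op_bound[OF assms(1)] by blast
  from positive_op_norm_squared_le[OF assms(1) this, of x] assms(2) show ?thesis
    by simp
qed

text \<open>Commutation gives \<open>(P + Q) (P - Q) = 0\<close>. At \<open>y = P x - Q x\<close>
  the two nonnegative quadratic forms therefore sum to zero, so \<open>P y = Q y = 0\<close>;
  self-adjointness then moves \<open>P - Q\<close> across to give
  \<open>cinner y y = 0\<close>.\<close>

lemma positive_op_eq_if_commute:
  fixes P Q :: "'a::chilbert_space \<Rightarrow> 'a"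
  assumes "positive_op P" "positive_op Q" "P \<circ> P = Q \<circ> Q" "P \<circ> Q = Q \<circ> P"
  shows "P = Q"
proof
  fix x
  interpret P: bounded_linear P using assms(1) by (rule positive_op_bounded_linear)
  interpret Q: bounded_linear Q using assms(2) by (rule positive_op_bounded_linear)
  define y where "y = P x - Q x"
  have "P y + Q y = 0"
    using fun_cong[OF assms(3), of x] fun_cong[OF assms(4), of x]
    by (simp add: y_def P.diff Q.diff)
  then have "Re (cinner (P y) y) + Re (cinner (Q y) y) = 0"
    by (metis cinner_add_left cinner_eq_zero_iff cinner_minus_left add.right_inverse
        eq_neg_iff_add_eq_0 plus_complex.simps(1) zero_complex.simps(1))
  moreover have "0 \<le> Re (cinner (P y) y)" "0 \<le> Re (cinner (Q y) y)"
    using assms by (auto simp: positive_op_def)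
  ultimately have "P y = 0" "Q y = 0"
    using assms by (auto intro: positive_op_eq_zero)
  moreover have "cinner y y = cinner x (P y) - cinner x (Q y)"
    by (simp add: y_def cinner_diff_left positive_op_selfadjoint[OF assms(1)]
        positive_op_selfadjoint[OF assms(2)])
  ultimately have "cinner y y = 0" by simp
  then show "P x = Q x"
    by (simp add: cinner_eq_zero_iff y_def)
qed

section \<open>Square root iteration and its scalar majorant\<close>

fun root_iter :: "('a::banach \<Rightarrow>\<^sub>L 'a) \<Rightarrow> nat \<Rightarrow> 'a \<Rightarrow>\<^sub>L 'a" where
  "root_iter B 0 = 0"
| "root_iter B (Suc n) = (1/2) *\<^sub>R (B + (root_iter B n o\<^sub>L root_iter B n))"

fun root_majorant :: "nat \<Rightarrow> real" where
  "root_majorant 0 = 0"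
| "root_majorant (Suc n) = (1 + (root_majorant n)\<^sup>2) / 2"

lemma root_majorant_bounds: "0 \<le> root_majorant n \<and> root_majorant n \<le> 1"
  by (induction n) (auto simp: power_le_one)

lemma root_majorant_mono: "root_majorant n \<le> root_majorant (Suc n)"
proof -
  have "0 \<le> (root_majorant n - 1)\<^sup>2" by simp
  then show ?thesis by (simp add: power2_diff)
qed

lemma norm_root_iter_le:
  assumes "norm B \<le> 1"
  shows "norm (root_iter B n) \<le> root_majorant n"
proof (induction n)
  case (Suc n)
  have "norm (root_iter B n o\<^sub>L root_iter B n) \<le> norm (root_iter B n) * norm (root_iter B n)"
    by (rule norm_blinfun_compose)
  also have "\<dots> \<le> (root_majorant n)\<^sup>2"
    unfolding power2_eq_square using Suc root_majorant_bounds by (intro mult_mono) auto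
  finally show ?case
    using assms norm_triangle_ineq[of B "root_iter B n o\<^sub>L root_iter B n"] by simp
qed simp

lemma norm_root_iter_step:
  assumes "norm B \<le> 1"
  shows "norm (root_iter B (Suc n) - root_iter B n) \<le> root_majorant (Suc n) - root_majorant n"
proof (induction n)
  case 0
  then show ?case using assms by simp
next
  case (Suc n)
  let ?Y = "root_iter B" and ?y = root_majorant
  define D where "D = ?Y (Suc n) - ?Y n"
  have D: "norm D \<le> ?y (Suc n) - ?y n"
    using Suc by (simp add: D_def)
  have "?Y (Suc (Suc n)) - ?Y (Suc n)
      = (1/2) *\<^sub>R (B + (?Y (Suc n) o\<^sub>L ?Y (Suc n))) - (1/2) *\<^sub>R (B + (?Y n o\<^sub>L ?Y n))"
    by (rule arg_cong2[where f = minus]) (rule root_iter.simps)+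
  also have "\<dots> = (1/2) *\<^sub>R ((?Y (Suc n) o\<^sub>L ?Y (Suc n)) - (?Y n o\<^sub>L ?Y n))"
    by (simp only: scaleR_diff_right[symmetric] add_diff_cancel_left)
  \<comment> \<open>A difference of squares with the factors kept in order; the scalar iteration
    splits in the same way, so the bounds match term by term.\<close>
  also have "(?Y (Suc n) o\<^sub>L ?Y (Suc n)) - (?Y n o\<^sub>L ?Y n) = (?Y (Suc n) o\<^sub>L D) + (D o\<^sub>L ?Y n)"
    unfolding D_def
    by (rule blinfun_eqI) (simp add: blinfun.bilinear_simps del: root_iter.simps)
  finally have step: "?Y (Suc (Suc n)) - ?Y (Suc n) = (1/2) *\<^sub>R ((?Y (Suc n) o\<^sub>L D) + (D o\<^sub>L ?Y n))" .
  have "norm (?Y (Suc (Suc n)) - ?Y (Suc n)) \<le> (norm (?Y (Suc n) o\<^sub>L D) + norm (D o\<^sub>L ?Y n)) / 2"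
    unfolding step using norm_triangle_ineq[of "?Y (Suc n) o\<^sub>L D" "D o\<^sub>L ?Y n"]
    by (simp del: root_iter.simps)
  also have "\<dots> \<le> (?y (Suc n) * (?y (Suc n) - ?y n) + (?y (Suc n) - ?y n) * ?y n) / 2"
  proof -
    have "norm (?Y (Suc n) o\<^sub>L D) \<le> ?y (Suc n) * (?y (Suc n) - ?y n)"
      using norm_blinfun_compose
      by (rule order_trans)
        (intro mult_mono norm_root_iter_le assms D; simp add: root_majorant_bounds del: root_majorant.simps)
    moreover have "norm (D o\<^sub>L ?Y n) \<le> (?y (Suc n) - ?y n) * ?y n"
      using norm_blinfun_compose
      by (rule order_trans)
        (intro mult_mono norm_root_iter_le assms D; simp add: root_majorant_mono del: root_majorant.simps)
    ultimately show ?thesis by (rule divide_right_mono[OF add_mono]) simp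
  qed
  also have "\<dots> = (1 + (?y (Suc n))\<^sup>2) / 2 - (1 + (?y n)\<^sup>2) / 2"
    by (simp add: power2_eq_square algebra_simps add_divide_distrib diff_divide_distrib del: root_majorant.simps)
  also have "\<dots> = ?y (Suc (Suc n)) - ?y (Suc n)"
    by (simp only: root_majorant.simps)
  finally show ?case .
qed

text \<open>The majorant is increasing and bounded, so its increments are summable and dominate
  those of the operator iteration.\<close>

lemma root_iter_convergent:
  assumes "norm B \<le> 1"
  shows "convergent (root_iter B)"
proof -
  have "convergent root_majorant"
    by (intro Bseq_monoseq_convergent BseqI'[of _ 1] incseq_imp_monoseq incseq_SucI)
      (use root_majorant_bounds root_majorant_mono in auto)
  then have "summable (\<lambda>n. root_majorant (Suc n) - root_majorant n)"
    by (simp add: telescope_summable convergent_LIMSEQ_iff del: root_majorant.simps)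
  then have "summable (\<lambda>n. root_iter B (Suc n) - root_iter B n)"
    by (rule summable_comparison_test') (rule norm_root_iter_step[OF assms])
  then have "convergent (\<lambda>n. \<Sum>k<n. root_iter B (Suc k) - root_iter B k)"
    by (simp add: summable_iff_convergent)
  \<comment> \<open>The iteration starts at 0, so the telescoping partial sums are the iterates
    themselves.\<close>
  then show ?thesis
    by (simp only: sum_lessThan_telescope root_iter.simps(1)) simp
qed

text \<open>With \<open>B = I - A/K\<close> of norm at most 1, the limit \<open>Y\<close> of the iteration satisfies
  \<open>2Y = B + Y\<^sup>2\<close>, that is, \<open>(I - Y)\<^sup>2 = A/K\<close>.\<close>

lemma positive_root_exists:
  fixes A :: "'a::chilbert_space \<Rightarrow> 'a"
  assumes A: "positive_op A"
  shows "\<exists>P. positive_op P \<and> P \<circ> P = A \<and>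
    (\<forall>Q. bounded_linear Q \<longrightarrow> A \<circ> Q = Q \<circ> A \<longrightarrow> P \<circ> Q = Q \<circ> P)"
proof -
  interpret A: bounded_linear A using A by (rule positive_op_bounded_linear)
  obtain K where K: "0 < K" "\<And>x. norm (A x) \<le> K * norm x"
    using positive_op_bound[OF A] by blast
  define B where "B = Blinfun (\<lambda>x. x - (1/K) *\<^sub>R A x)"
  have B: "blinfun_apply B x = x - (1/K) *\<^sub>R A x" for x
    unfolding B_def
    by (subst bounded_linear_Blinfun_apply)
      (auto intro!: bounded_linear_sub bounded_linear_ident
        bounded_linear_compose[OF bounded_linear_scaleR_right] A.bounded_linear_axioms)
  have "norm B \<le> 1"
  proof (rule norm_blinfun_bound)
    fix x
    have "(norm (B x))\<^sup>2 = (norm x)\<^sup>2 - 2 / K * Re (cinner (A x) x) + (1/K)\<^sup>2 * (norm (A x))\<^sup>2"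
      using norm_add_scaleR_squared[of x "- (1/K)" "A x"] Re_cinner_commute[of x "A x"]
      by (simp add: B)
    \<comment> \<open>The quadratic term is at most half of the subtracted one, which makes
      \<open>B\<close> a contraction.\<close>
    also have "\<dots> \<le> (norm x)\<^sup>2 - 2 / K * Re (cinner (A x) x) + (1/K)\<^sup>2 * (K * Re (cinner (A x) x))"
      by (intro add_left_mono mult_left_mono positive_op_norm_squared_le[OF A K]) simp
    also have "\<dots> = (norm x)\<^sup>2 - Re (cinner (A x) x) / K"
      using K(1) by (simp add: power2_eq_square field_simps)
    also have "\<dots> \<le> (norm x)\<^sup>2"
      using A K(1) by (simp add: positive_op_def)
    finally show "norm (B x) \<le> 1 * norm x"
      by simp
  qed simp
  then have "convergent (root_iter B)" and bound: "\<And>n. norm (root_iter B n) \<le> 1"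
    using root_iter_convergent norm_root_iter_le root_majorant_bounds order_trans by blast+
  then obtain Y where Y: "root_iter B \<longlonglongrightarrow> Y"
    by (auto simp: convergent_def)
  have Yx: "(\<lambda>n. root_iter B n x) \<longlonglongrightarrow> Y x" for x
    by (intro blinfun.tendsto Y tendsto_const)
  have "(\<lambda>n. root_iter B (Suc n)) \<longlonglongrightarrow> (1/2) *\<^sub>R (B + (Y o\<^sub>L Y))"
    unfolding root_iter.simps(2)
    by (intro tendsto_intros bounded_bilinear.tendsto[OF bounded_bilinear_blinfun_compose] Y)
  then have "Y = (1/2) *\<^sub>R (B + (Y o\<^sub>L Y))"
    using LIMSEQ_Suc[OF Y] by (rule LIMSEQ_unique[rotated])
  then have "2 *\<^sub>R Y = B + (Y o\<^sub>L Y)"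
    by (metis (no_types) scaleR_half_double scaleR_2 scaleR_right_distrib)
  then have fixp: "Y x + Y x = B x + Y (Y x)" for x
    by (metis blinfun.add_left blinfun_apply_blinfun_compose scaleR_2)
  have "norm Y \<le> 1"
    using tendsto_norm[OF Y] bound by (intro LIMSEQ_le_const2) auto
  then have norm_Y: "norm (Y x) \<le> norm x" for x
    using norm_blinfun[of Y x] mult_right_mono[of "norm Y" 1 "norm x"] by simp
  \<comment> \<open>The type of the iterates records real linearity only, so complex homogeneity is
    carried through the iteration and then to the limit.\<close>
  have iter_scaleC: "root_iter B n (c *\<^sub>C x) = c *\<^sub>C root_iter B n x" for n c x
  proof (induction n arbitrary: x)
    case 0
    show ?case
      by (simp, metis add_cancel_right_left scaleC_add_right)
  next
    case (Suc n)
    have scaleRC: "r *\<^sub>R (c *\<^sub>C z) = c *\<^sub>C (r *\<^sub>R z)" for r and z :: 'a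
      by (simp add: scaleR_scaleC scaleC_scaleC mult.commute)
    have diffC: "c *\<^sub>C (u - v) = c *\<^sub>C u - c *\<^sub>C v" for u v :: 'a
      by (metis add_diff_cancel_right' diff_add_cancel scaleC_add_right)
    have "A (c *\<^sub>C x) = c *\<^sub>C A x"
      using A by (simp add: positive_op_def bounded_clinear_def)
    then show ?case
      by (simp add: Suc blinfun.add_left blinfun.scaleR_left B scaleRC
          flip: diffC scaleC_add_right)
  qed
  have Y_scaleC: "Y (c *\<^sub>C x) = c *\<^sub>C Y x" for c x
  proof (rule cinner_eqI)
    fix z
    have "(\<lambda>n. cinner z (root_iter B n (c *\<^sub>C x))) \<longlonglongrightarrow> cinner z (Y (c *\<^sub>C x))"
      by (intro tendsto_intros Yx)
    moreover have "(\<lambda>n. cinner z (root_iter B n (c *\<^sub>C x))) \<longlonglongrightarrow> cinner z (c *\<^sub>C Y x)"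
      unfolding iter_scaleC cinner_scaleC_right by (intro tendsto_intros Yx)
    ultimately show "cinner z (Y (c *\<^sub>C x)) = cinner z (c *\<^sub>C Y x)"
      by (rule LIMSEQ_unique)
  qed
  have iter_selfadj: "cinner (root_iter B n x) y = cinner x (root_iter B n y)" for n x y
  proof (induction n arbitrary: x y)
    case 0
    show ?case
      using cinner_scaleR_left[of 0 0 y] cinner_scaleR_right[of x 0 0] by simp
  next
    case (Suc n)
    then show ?case
      by (simp add: blinfun.add_left blinfun.scaleR_left B cinner_simps positive_op_selfadjoint[OF A])
  qed
  have Y_selfadj: "cinner (Y x) y = cinner x (Y y)" for x y
  proof (rule LIMSEQ_unique)
    show "(\<lambda>n. cinner (root_iter B n x) y) \<longlonglongrightarrow> cinner (Y x) y"
      by (intro tendsto_intros Yx)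
    show "(\<lambda>n. cinner (root_iter B n x) y) \<longlonglongrightarrow> cinner x (Y y)"
      unfolding iter_selfadj by (intro tendsto_intros Yx)
  qed
  \<comment> \<open>The iterates are polynomials in \<open>A\<close>, hence commute with
    \<open>Q\<close>; continuity of \<open>Q\<close> passes this to the limit.\<close>
  have Y_commute: "Y (Q x) = Q (Y x)" if Q: "bounded_linear Q" "A \<circ> Q = Q \<circ> A" for Q x
  proof (rule LIMSEQ_unique)
    interpret Q: bounded_linear Q by fact
    have "root_iter B n (Q x) = Q (root_iter B n x)" for n x
    proof (induction n arbitrary: x)
      case (Suc n)
      then show ?case
        using fun_cong[OF Q(2), of x]
        by (simp add: blinfun.add_left blinfun.scaleR_left B Q.add Q.diff Q.scaleR)
    qed (simp add: Q.zero)
    then show "(\<lambda>n. root_iter B n (Q x)) \<longlonglongrightarrow> Q (Y x)"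
      using Q.tendsto[OF Yx] by simp
  qed (rule Yx)
  \<comment> \<open>The factor \<open>sqrt K\<close> undoes the normalisation of \<open>A\<close>.
    Self-adjointness of \<open>Y\<close> makes the quadratic form real, and \<open>norm_Y\<close>
    makes it nonnegative.\<close>
  define P where "P x = sqrt K *\<^sub>R (x - Y x)" for x
  have "bounded_clinear P"
  proof -
    have "bounded_linear P"
      unfolding P_def
      by (intro bounded_linear_compose[OF bounded_linear_scaleR_right]
          bounded_linear_sub bounded_linear_ident blinfun.bounded_linear_right)
    moreover have "P (c *\<^sub>C x) = c *\<^sub>C P x" for c x
      by (rule cinner_eqI) (simp add: P_def Y_scaleC cinner_simps algebra_simps)
    ultimately show ?thesis
      by (simp add: bounded_clinear_def)
  qed
  moreover have "Im (cinner (P x) x) = 0" for x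
  proof -
    have "cinner (Y x) x = cnj (cinner (Y x) x)"
      using Y_selfadj[of x x] cinner_commute[of x "Y x"] by simp
    then have "Im (cinner (Y x) x) = 0"
      by (simp add: complex_eq_iff)
    then show ?thesis
      by (simp add: P_def cinner_simps cinner_self flip: of_real_power)
  qed
  moreover have "0 \<le> Re (cinner (P x) x)" for x
  proof -
    have "Re (cinner (Y x) x) \<le> norm (Y x) * norm x"
      using complex_Re_le_cmod cinner_Cauchy_Schwarz by (rule order_trans)
    also have "\<dots> \<le> norm x * norm x"
      by (intro mult_right_mono norm_Y) simp
    finally show ?thesis
      using K(1) by (simp add: P_def cinner_simps Re_cinner_self power2_eq_square)
  qed
  ultimately have "positive_op P"
    by (simp add: positive_op_def)
  moreover have "P \<circ> P = A"
  proof
    fix x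
    have "(P \<circ> P) x = (sqrt K * sqrt K) *\<^sub>R (x - (Y x + Y x) + Y (Y x))"
      by (simp add: P_def blinfun.diff_right blinfun.scaleR_right algebra_simps)
    also have "\<dots> = K *\<^sub>R (x - B x)"
      unfolding fixp using K(1) by (simp add: algebra_simps)
    also have "\<dots> = A x"
      using K(1) by (simp add: B)
    finally show "(P \<circ> P) x = A x" .
  qed
  moreover have "P \<circ> Q = Q \<circ> P" if "bounded_linear Q" "A \<circ> Q = Q \<circ> A" for Q
    using Y_commute[OF that] linear_diff[OF bounded_linear.linear[OF that(1)]]
      linear_scale[OF bounded_linear.linear[OF that(1)]]
    by (auto simp: P_def fun_eq_iff)
  ultimately show ?thesis
    by blast
qed

text \<open>Any positive root \<open>Q\<close> commutes with \<open>A = Q \<circ> Q\<close>, hence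
  with the constructed root \<open>P\<close>, and commuting positive roots coincide. This settles
  the definite description.\<close>

lemma sqrt_op_squared:
  fixes A :: "'a::chilbert_space \<Rightarrow> 'a"
  assumes "positive_op A"
  shows "sqrt_op A \<circ> sqrt_op A = A"
proof -
  obtain P where P: "positive_op P" "P \<circ> P = A"
    and comm: "\<And>Q. bounded_linear Q \<Longrightarrow> A \<circ> Q = Q \<circ> A \<Longrightarrow> P \<circ> Q = Q \<circ> P"
    using positive_root_exists[OF assms] by blast
  have "sqrt_op A = P"
    unfolding sqrt_op_def
  proof (rule the_equality)
    show "positive_op P \<and> P \<circ> P = A"
      using P by simp
    fix Q
    assume Q: "positive_op Q \<and> Q \<circ> Q = A"
    then have "P \<circ> Q = Q \<circ> P"
      by (intro comm positive_op_bounded_linear) (auto simp: o_assoc)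
    then show "Q = P"
      using positive_op_eq_if_commute[OF P(1), of Q] P(2) Q by simp
  qed
  then show ?thesis
    using P(2) by simp
qed

text \<open>The bounds below use only this about \<open>abs_op T\<close>, as only its even powers
  occur there.\<close>

lemma abs_op_squared:
  fixes T :: "'a::chilbert_space \<Rightarrow> 'a"
  assumes "bounded_clinear T"
  shows "abs_op T (abs_op T x) = cadjoint T (T x)"
  using fun_cong[OF sqrt_op_squared[OF positive_op_cadjoint_comp[OF assms]], of x]
  by (simp add: abs_op_def)

section \<open>Bounds for the Davis-Wielandt radius\<close>

lemma norm_apply_unit_le:
  "\<lbrakk>bounded_linear f; norm x = 1\<rbrakk> \<Longrightarrow> norm (f x) \<le> onorm f"
  using onorm[of f x] by simp

lemma cmod_cinner_unit_le: "norm x = 1 \<Longrightarrow> cmod (cinner y x) \<le> norm y"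
  using cinner_Cauchy_Schwarz[of y x] by simp

lemma cmod_cinner_unit_le_onorm:
  "\<lbrakk>bounded_linear f; norm x = 1\<rbrakk> \<Longrightarrow> cmod (cinner (f x) x) \<le> onorm f"
  using cmod_cinner_unit_le[of x "f x"] norm_apply_unit_le[of f x] by linarith

lemma numerical_radius_bdd_above:
  fixes T :: "'a::chilbert_space \<Rightarrow> 'a"
  assumes "bounded_linear T"
  shows "bdd_above (insert 0 {cmod (cinner (T x) x) |x. norm x = 1})"
  using assms
  by (auto intro!: bdd_aboveI[of _ "onorm T"] cmod_cinner_unit_le_onorm onorm_pos_le)

lemma numerical_radius_upper:
  fixes T :: "'a::chilbert_space \<Rightarrow> 'a"
  assumes "bounded_linear T" "norm x = 1"
  shows "cmod (cinner (T x) x) \<le> numerical_radius T"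
  unfolding numerical_radius_def
  using assms(2) by (intro cSup_upper numerical_radius_bdd_above assms(1)) auto

lemma numerical_radius_nonneg:
  fixes T :: "'a::chilbert_space \<Rightarrow> 'a"
  assumes "bounded_linear T"
  shows "0 \<le> numerical_radius T"
  unfolding numerical_radius_def
  by (intro cSup_upper numerical_radius_bdd_above assms) auto

text \<open>The hypothesis \<open>0 \<le> M\<close> handles the inserted 0, and with it the zero
  space; that same 0 makes the radius nonnegative, as squaring the bound \<open>sqrt M\<close>
  requires.\<close>

lemma davis_wielandt_radius_squared_le:
  fixes T :: "'a::chilbert_space \<Rightarrow> 'a"
  assumes "0 \<le> M"
    and "\<And>x. norm x = 1 \<Longrightarrow> (cmod (cinner (T x) x))\<^sup>2 + norm (T x) ^ 4 \<le> M"
  shows "(davis_wielandt_radius T)\<^sup>2 \<le> M"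
proof -
  let ?S = "insert 0 {sqrt ((cmod (cinner (T x) x))\<^sup>2 + norm (T x) ^ 4) |x. norm x = 1}"
  have le: "s \<le> sqrt M" if "s \<in> ?S" for s
    using that assms by auto
  have "davis_wielandt_radius T \<le> sqrt M"
    unfolding davis_wielandt_radius_def using le by (intro cSup_least) auto
  moreover have "0 \<le> davis_wielandt_radius T"
    unfolding davis_wielandt_radius_def using le by (intro cSup_upper bdd_aboveI[of _ "sqrt M"]) simp_all
  ultimately have "(davis_wielandt_radius T)\<^sup>2 \<le> (sqrt M)\<^sup>2"
    by (intro power_mono)
  then show ?thesis
    using assms(1) by simp
qed

theorem theorem2p17:
  fixes T :: "'a::chilbert_space \<Rightarrow> 'a"
  assumes "bounded_clinear T"
  shows "(davis_wielandt_radius T)\<^sup>2 \<le> onorm (\<lambda>x. (abs_op T ^^ 2) x + (abs_op T ^^ 4) x)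
    \<and> (davis_wielandt_radius T)\<^sup>2
           \<le> 1 / 2 * (numerical_radius (T ^^ 2) + (onorm T)\<^sup>2) + onorm T ^ 4"
proof
  have T: "bounded_linear T"
    using assms by (rule bounded_clinear_bounded_linear)
  define A where "A x = cadjoint T (T x)" for x
  have A: "bounded_linear A"
    unfolding A_def
    by (intro bounded_linear_compose[OF bounded_clinear_bounded_linear T]
        bounded_clinear_cadjoint assms)
  have inner_A: "cinner (A x) y = cinner x (A y)" for x y
    using positive_op_selfadjoint[OF positive_op_cadjoint_comp[OF assms], of x y]
    by (simp add: A_def)
  have Re_A: "Re (cinner (A x) x) = (norm (T x))\<^sup>2" for x
    unfolding inner_A by (simp add: A_def Re_cinner_self flip: cinner_cadjoint[OF assms])
  have abs_eq: "(\<lambda>x. (abs_op T ^^ 2) x + (abs_op T ^^ 4) x) = (\<lambda>x. A x + A (A x))"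
    by (simp add: eval_nat_numeral abs_op_squared[OF assms] A_def)
  have AA: "bounded_linear (\<lambda>x. A x + A (A x))"
    by (intro bounded_linear_add bounded_linear_compose[OF A] A)
  show "(davis_wielandt_radius T)\<^sup>2 \<le> onorm (\<lambda>x. (abs_op T ^^ 2) x + (abs_op T ^^ 4) x)"
    unfolding abs_eq
  proof (rule davis_wielandt_radius_squared_le)
    fix x :: 'a
    assume x: "norm x = 1"
    have "(norm (T x))\<^sup>2 \<le> norm (A x)"
      using order_trans[OF complex_Re_le_cmod cmod_cinner_unit_le[OF x], of "A x"]
      by (simp add: Re_A)
    then have "((norm (T x))\<^sup>2)\<^sup>2 \<le> (norm (A x))\<^sup>2"
      by (intro power_mono) auto
    then have "norm (T x) ^ 4 \<le> (norm (A x))\<^sup>2"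
      by (simp flip: power_mult)
    moreover have "(cmod (cinner (T x) x))\<^sup>2 \<le> (norm (T x))\<^sup>2"
      by (intro power_mono cmod_cinner_unit_le x) simp
    ultimately have "(cmod (cinner (T x) x))\<^sup>2 + norm (T x) ^ 4 \<le> (norm (T x))\<^sup>2 + (norm (A x))\<^sup>2"
      by linarith
    also have "\<dots> = Re (cinner (A x + A (A x)) x)"
      by (simp add: cinner_add_left Re_A inner_A[of "A x"] Re_cinner_self)
    also have "\<dots> \<le> onorm (\<lambda>x. A x + A (A x))"
      using order_trans[OF complex_Re_le_cmod cmod_cinner_unit_le_onorm[OF AA x]] by simp
    finally show "(cmod (cinner (T x) x))\<^sup>2 + norm (T x) ^ 4 \<le> onorm (\<lambda>x. A x + A (A x))" .
  qed (rule onorm_pos_le[OF AA])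
  have T2: "bounded_linear (T ^^ 2)"
    using bounded_linear_compose[OF T T] by (simp add: eval_nat_numeral o_def)
  show "(davis_wielandt_radius T)\<^sup>2
      \<le> 1 / 2 * (numerical_radius (T ^^ 2) + (onorm T)\<^sup>2) + onorm T ^ 4"
  proof (rule davis_wielandt_radius_squared_le)
    fix x :: 'a
    assume x: "norm x = 1"
    \<comment> \<open>At \<open>y = x\<close> this makes both factors in Buzano's product equal to
      \<open>cinner (T x) x\<close>; at \<open>y = T x\<close> it produces the \<open>T ^^ 2\<close>
      term.\<close>
    have adj: "cinner y (cadjoint T x) = cinner (T y) x" for y
      by (simp add: cinner_cadjoint[OF assms])
    have "(cmod (cinner (T x) x))\<^sup>2 = cmod (cinner (T x) x * cinner x (cadjoint T x))"
      by (simp add: adj norm_mult power2_eq_square)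
    also have "\<dots> \<le> (cmod (cinner ((T ^^ 2) x) x) + norm (T x) * norm (cadjoint T x)) / 2"
      using Buzano[OF x, of "T x" "cadjoint T x"] by (simp add: adj eval_nat_numeral)
    also have "\<dots> \<le> (numerical_radius (T ^^ 2) + onorm T * onorm T) / 2"
      using norm_cadjoint_le[OF assms, of x] x
      by (intro divide_right_mono add_mono mult_mono numerical_radius_upper T2
          norm_apply_unit_le T onorm_pos_le) auto
    finally have "(cmod (cinner (T x) x))\<^sup>2
        \<le> 1 / 2 * (numerical_radius (T ^^ 2) + (onorm T)\<^sup>2)"
      by (simp add: power2_eq_square)
    moreover have "norm (T x) ^ 4 \<le> onorm T ^ 4"
      by (intro power_mono norm_apply_unit_le T x) simp
    ultimately show "(cmod (cinner (T x) x))\<^sup>2 + norm (T x) ^ 4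
        \<le> 1 / 2 * (numerical_radius (T ^^ 2) + (onorm T)\<^sup>2) + onorm T ^ 4"
      by (rule add_mono)
  qed (use numerical_radius_nonneg[OF T2] onorm_pos_le[OF T] in simp)
qed

end
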